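(* Let $\Phi$ be the $n\times N$ matrix with entries $\phi_{jl}=\Pr(Z\in B_l\mid X=x_j)-\Pr(Z\in B_l)$, and for $P=(P_{il})_{1\le i\le m,\,1\le l\le N}$ let $\boldsymbol{P}_i=(P_{i1},\dots,P_{iN})^\top$. The optimal perfect privacy estimator with discretized measurements (the minimizer of $\mathsf{E}[L(Y,\hat Y_P(Z))]$ over all $P$ with $P_{il}\ge0$, $\sum_iP_{il}=1$ for all $l$, and $\hat Y_P(Z)$ independent of $X$) is given by the solution of $$\text{minimize } \mathsf{E}\big[L(Y,\hat Y_P(Z))\big]\quad\text{subject to}\quad P_{il}\ge0\ \ \forall i,l,\qquad \sum_{i=1}^mP_{il}=1\ \ \forall l,\qquad \Phi\boldsymbol{P}_i=\boldsymbol{0}\ \ \forall i,$$ and this is a finite-dimensional linear optimization problem: all constraints are linear in $P$, and the objective is linear in $P$ up to an additive constant, being equal to $1-\sum_{i,l}P_{il}\Pr(Z\in B_l\mid Y=y_i)\Pr(Y=y_i)$.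
   Context: $X$ (private) and $Y$ (public) are possibly correlated discrete random variables with finite support sets $\mathcal{X}=\{x_1,\dots,x_n\}$ and $\mathcal{Y}=\{y_1,\dots,y_m\}$ (so all these values have positive probability). The measurement $Z$ is a real random variable, jointly distributed with $(X,Y)$, absolutely continuous with respect to Lebesgue measure. $\{B_l\}_{l=1}^N$ is a partition of $\mathbb{R}$ into intervals (up to endpoints, which have probability zero), with $B_1,B_N$ semi-infinite and $B_2,\dots,B_{N-1}$ bounded. Randomized estimator from discretized measurements: $\hat Y_P(Z)$ is the $\mathcal{Y}$-valued random variable that equals $y_i$ with probability $P_{il}$ when $Z\in B_l$, the randomization being conditionally independent of $(X,Y)$ given $Z$. Loss: $L(Y,\hat Y)=1$ if $Y\neq\hat Y$, and $0$ otherwise. *)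

theory Defs
  imports "HOL-Probability.Probability"
begin

definition semi_infinite :: "real set \<Rightarrow> bool" where
  "semi_infinite S \<longleftrightarrow> (\<exists>a. S = {..<a} \<or> S = {..a} \<or> S = {a<..} \<or> S = {a..})"

text \<open>
  The cells \<open>B\<^sub>1, \<dots>, B\<^sub>N\<close> are indexed by a finite linearly ordered type, so that
  \<open>B\<^sub>1\<close> and \<open>B\<^sub>N\<close> are the cells at the least and the greatest index. Being a partition up to
  endpoints means that cells may share or miss endpoints, hence the interiors and closures.
  The two outer cells being semi-infinite excludes \<open>N = 1\<close>.
\<close>
definition interval_partition :: "('l::{finite,linorder} \<Rightarrow> real set) \<Rightarrow> bool" where
  "interval_partition B \<longleftrightarrow>
     (\<forall>l. is_interval (B l) \<and> interior (B l) \<noteq> {}) \<and>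
     (\<forall>l l'. l \<noteq> l' \<longrightarrow> interior (B l) \<inter> interior (B l') = {}) \<and>
     (\<Union>l. closure (B l)) = UNIV \<and>
     semi_infinite (B (Min UNIV)) \<and> semi_infinite (B (Max UNIV)) \<and>
     (\<forall>l. l \<noteq> Min UNIV \<and> l \<noteq> Max UNIV \<longrightarrow> bounded (B l))"

definition loss :: "'b \<Rightarrow> 'b \<Rightarrow> real" where
  "loss y y' = (if y \<noteq> y' then 1 else 0)"

definition generated_algebra :: "'w measure \<Rightarrow> ('w \<Rightarrow> real) \<Rightarrow> 'w measure" where
  "generated_algebra M Z = vimage_algebra (space M) Z borel"

text \<open>
  The library's \<open>indep_var\<close> wants both variables to have the same value type; this is its
  characterization \<open>indep_var_eq\<close> for two different ones.
\<close>
definition independent_rvs ::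
  "'w measure \<Rightarrow> 'u measure \<Rightarrow> ('w \<Rightarrow> 'u) \<Rightarrow> 'v measure \<Rightarrow> ('w \<Rightarrow> 'v) \<Rightarrow> bool" where
  "independent_rvs M S U T V \<longleftrightarrow>
     U \<in> measurable M S \<and> V \<in> measurable M T \<and>
     prob_space.indep_set M (sets (vimage_algebra (space M) U S)) (sets (vimage_algebra (space M) V T))"

definition cond_indep_given ::
  "'w measure \<Rightarrow> ('w \<Rightarrow> real) \<Rightarrow> 'u measure \<Rightarrow> ('w \<Rightarrow> 'u) \<Rightarrow> 'v measure \<Rightarrow> ('w \<Rightarrow> 'v) \<Rightarrow> bool" where
  "cond_indep_given M Z S U T V \<longleftrightarrow>
     (\<forall>A\<in>sets S. \<forall>C\<in>sets T. AE \<omega> in M.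
        real_cond_exp M (generated_algebra M Z)
          (indicator {\<omega>\<in>space M. U \<omega> \<in> A \<and> V \<omega> \<in> C}) \<omega> =
        real_cond_exp M (generated_algebra M Z) (indicator {\<omega>\<in>space M. U \<omega> \<in> A}) \<omega> *
        real_cond_exp M (generated_algebra M Z) (indicator {\<omega>\<in>space M. V \<omega> \<in> C}) \<omega>)"

type_synonym ('m, 'l) randomization = "real^'l^'m"

definition column_stochastic :: "('m::finite, 'l::finite) randomization \<Rightarrow> bool" where
  "column_stochastic P \<longleftrightarrow> (\<forall>i l. 0 \<le> P $ i $ l) \<and> (\<forall>l. (\<Sum>i\<in>UNIV. P $ i $ l) = 1)"

text \<open>
  \<open>W\<close> is a version of the estimator with randomization \<open>P\<close>. Only \<open>W\<close> is constrained here; the underlying space has to be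
  rich enough to carry the randomization (a product with the unit interval always is).
\<close>
definition randomized_estimator ::
  "'w measure \<Rightarrow> ('n \<Rightarrow> 'a) \<Rightarrow> ('w \<Rightarrow> 'a) \<Rightarrow> ('m \<Rightarrow> 'b) \<Rightarrow> ('w \<Rightarrow> 'b) \<Rightarrow> ('w \<Rightarrow> real) \<Rightarrow>
   ('l \<Rightarrow> real set) \<Rightarrow> ('m::finite, 'l::finite) randomization \<Rightarrow> ('w \<Rightarrow> 'b) \<Rightarrow> bool" where
  "randomized_estimator M x X y Y Z B P W \<longleftrightarrow>
     W \<in> measurable M (count_space (range y)) \<and>
     (\<forall>i l. AE \<omega> in M. Z \<omega> \<in> B l \<longrightarrow>
        real_cond_exp M (generated_algebra M Z) (indicator {\<omega>\<in>space M. W \<omega> = y i}) \<omega> = P $ i $ l) \<and>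
     cond_indep_given M Z (count_space (range y)) W
       (count_space (range x \<times> range y)) (\<lambda>\<omega>. (X \<omega>, Y \<omega>))"

definition Phi ::
  "'w measure \<Rightarrow> ('n \<Rightarrow> 'a) \<Rightarrow> ('w \<Rightarrow> 'a) \<Rightarrow> ('w \<Rightarrow> real) \<Rightarrow> ('l \<Rightarrow> real set) \<Rightarrow> real^'l^'n" where
  "Phi M x X Z B = (\<chi> j l. \<P>(\<omega> in M. Z \<omega> \<in> B l \<bar> X \<omega> = x j) - \<P>(\<omega> in M. Z \<omega> \<in> B l))"

text \<open>A finite system of non-strict linear constraints is the same as membership in a polyhedron.\<close>
definition linear_optimization_problem :: "('v::euclidean_space \<Rightarrow> real) \<Rightarrow> 'v set \<Rightarrow> bool" where
  "linear_optimization_problem f S \<longleftrightarrow>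
     polyhedron S \<and> (\<exists>g c. linear g \<and> (\<forall>v\<in>S. f v = g v + c))"

end

theory Submission
  imports Defs
begin

text \<open>
  Write \<open>Y'\<close> for the estimator. Conditioning on \<open>Z\<close>, given which \<open>Y'\<close> takes the value \<open>y\<^sub>i\<close> with
  the probability \<open>P\<^sub>i\<^sub>l\<close> that is constant on \<open>B\<^sub>l\<close>, turns conditional independence into
  \<open>\<P>(Y' = y\<^sub>i, (X, Y) \<in> C) = \<Sum>\<^sub>l P\<^sub>i\<^sub>l \<P>(Z \<in> B\<^sub>l, (X, Y) \<in> C)\<close>. With \<open>C = {X = x\<^sub>j}\<close>, dividing by
  \<open>\<P>(X = x\<^sub>j)\<close> and subtracting \<open>\<P>(Y' = y\<^sub>i)\<close> gives the \<open>j\<close>-th entry of \<open>\<Phi> P\<^sub>i\<close>, so independence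
  of \<open>X\<close> is exactly \<open>\<Phi> P\<^sub>i = 0\<close> for all \<open>i\<close>; with \<open>C = {Y = y\<^sub>i}\<close> it gives the risk. A minimizer
  exists because the feasible set is a compact polyhedron containing the uniform randomization.
\<close>

section \<open>Cells of the partition and their boundaries\<close>

lemma interval_partition_borel:
  "interval_partition B \<Longrightarrow> B l \<in> sets borel"
  by (intro real_interval_borel_measurable) (auto simp: interval_partition_def)

text \<open>The cells are convex, so their frontiers are Lebesgue null. Off these finitely many
  frontiers, a cell, its interior and its closure have the same points; the closures cover the line,
  which gives existence, and the interiors are disjoint, which gives uniqueness.\<close>

lemma AE_unique_cell:
  assumes "Z \<in> borel_measurable M" and "absolutely_continuous lborel (distr M borel Z)"
    and "interval_partition B"
  shows "AE \<omega> in M. \<exists>!l. Z \<omega> \<in> B l"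
proof -
  have null: "frontier (B l) \<in> null_sets lborel" for l
  proof -
    have "negligible (frontier (B l))"
      using assms(3) by (intro negligible_convex_frontier is_interval_convex)
        (auto simp: interval_partition_def)
    then show ?thesis
      by (auto simp: negligible_iff_null_sets null_sets_completion_iff)
  qed
  \<comment> \<open>Absolute continuity makes Lebesgue null sets null for the law of
    \<open>Z\<close>; the statement is then pulled back along \<open>Z\<close> to
    \<open>M\<close>.\<close>
  have "AE z in distr M borel Z. z \<notin> (\<Union>l. frontier (B l))"
    using assms(2) null
    by (intro AE_not_in) (auto simp: absolutely_continuous_def intro!: null_sets_UN')
  then have "AE \<omega> in M. Z \<omega> \<notin> (\<Union>l. frontier (B l))"
    by (rule AE_distrD[OF assms(1)])
  then show ?thesis
  proof (rule AE_mp, intro AE_I2 impI)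
    fix \<omega> assume nf: "Z \<omega> \<notin> (\<Union>l. frontier (B l))"
    have int: "Z \<omega> \<in> interior (B l) \<longleftrightarrow> Z \<omega> \<in> closure (B l)" for l
      using nf interior_subset[of "B l"] closure_subset[of "B l"] by (auto simp: frontier_def)
    have mem: "Z \<omega> \<in> B l \<longleftrightarrow> Z \<omega> \<in> interior (B l)" for l
      using int interior_subset[of "B l"] closure_subset[of "B l"] by blast
    have "Z \<omega> \<in> (\<Union>l. closure (B l))"
      using assms(3) by (simp add: interval_partition_def)
    then show "\<exists>!l. Z \<omega> \<in> B l"
      using assms(3) int mem unfolding interval_partition_def by blast
  qed
qed

section \<open>Independence of finitely valued random variables\<close>

context prob_space
begin

lemma integrable_indicator_event:
  "A \<in> events \<Longrightarrow> integrable M (indicator A :: 'a \<Rightarrow> real)"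
  by (simp add: emeasure_eq_measure)

lemma prob_in_finite:
  assumes T: "T \<in> measurable M (count_space S)" and "finite A" "A \<subseteq> S"
  shows "prob (T -` A \<inter> space M) = (\<Sum>a\<in>A. prob {\<omega>\<in>space M. T \<omega> = a})"
proof -
  have "prob (\<Union>a\<in>A. T -` {a} \<inter> space M) = (\<Sum>a\<in>A. prob (T -` {a} \<inter> space M))"
    using assms by (intro finite_measure_finite_Union)
      (auto simp: disjoint_family_on_def intro!: measurable_sets[OF T])
  moreover have "(\<Union>a\<in>A. T -` {a} \<inter> space M) = T -` A \<inter> space M" by auto
  moreover have "T -` {a} \<inter> space M = {\<omega>\<in>space M. T \<omega> = a}" for a by auto
  ultimately show ?thesis by simp
qed

text \<open>The product of discrete sigma-algebras on countable sets is discrete, so a pair can be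
  handled as one discrete variable.\<close>

lemma measurable_Pair_count_space:
  assumes "U \<in> measurable M (count_space A)" "V \<in> measurable M (count_space C)"
    and "countable A" "countable C"
  shows "(\<lambda>\<omega>. (U \<omega>, V \<omega>)) \<in> measurable M (count_space (A \<times> C))"
  using measurable_Pair[OF assms(1,2)] by (simp add: pair_measure_countable assms(3,4))

text \<open>The product rule on points suffices because the value sets are finite: the probability
  of a rectangle \<open>A \<times> C\<close> is a finite sum over its points, and the sum of
  products factors. Conversely, points are rectangles of singletons.\<close>

lemma independent_rvs_finite_iff:
  fixes u :: "'i::finite \<Rightarrow> 'u" and v :: "'j::finite \<Rightarrow> 'v"
  assumes U: "U \<in> measurable M (count_space (range u))"
    and V: "V \<in> measurable M (count_space (range v))"
  shows "independent_rvs M (count_space (range u)) U (count_space (range v)) V \<longleftrightarrow>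
    (\<forall>i j. prob {\<omega>\<in>space M. U \<omega> = u i \<and> V \<omega> = v j} =
       prob {\<omega>\<in>space M. U \<omega> = u i} * prob {\<omega>\<in>space M. V \<omega> = v j})" (is "_ \<longleftrightarrow> ?R")
proof -
  \<comment> \<open>All subsets of the range are measurable in \<open>count_space\<close>, so the
    generated sigma-algebra consists of the preimages of arbitrary subsets.\<close>
  have sets_eq: "sets (vimage_algebra (space M) T (count_space (range t))) =
      (\<lambda>A. T -` A \<inter> space M) ` Pow (range t)"
    if "T \<in> measurable M (count_space (range t))" for T :: "'a \<Rightarrow> 'c" and t :: "'d \<Rightarrow> 'c"
    using measurable_space[OF that] by (subst sets_vimage_algebra2) auto
  have UV: "(\<lambda>\<omega>. (U \<omega>, V \<omega>)) \<in> measurable M (count_space (range u \<times> range v))"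
    using U V by (intro measurable_Pair_count_space) auto
  have "indep_set (sets (vimage_algebra (space M) U (count_space (range u))))
          (sets (vimage_algebra (space M) V (count_space (range v)))) \<longleftrightarrow>
    (\<forall>A\<subseteq>range u. \<forall>C\<subseteq>range v. prob ((U -` A \<inter> space M) \<inter> (V -` C \<inter> space M)) =
       prob (U -` A \<inter> space M) * prob (V -` C \<inter> space M))"
    using measurable_sets[OF U] measurable_sets[OF V]
    by (auto simp: indep_sets2_eq sets_eq[OF U] sets_eq[OF V] image_subset_iff)
  also have "\<dots> \<longleftrightarrow> ?R"
  proof (intro iffI allI impI)
    fix i j
    assume *: "\<forall>A\<subseteq>range u. \<forall>C\<subseteq>range v. prob ((U -` A \<inter> space M) \<inter> (V -` C \<inter> space M)) =
       prob (U -` A \<inter> space M) * prob (V -` C \<inter> space M)"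
    have "(U -` {u i} \<inter> space M) \<inter> (V -` {v j} \<inter> space M) = {\<omega>\<in>space M. U \<omega> = u i \<and> V \<omega> = v j}"
      "U -` {u i} \<inter> space M = {\<omega>\<in>space M. U \<omega> = u i}"
      "V -` {v j} \<inter> space M = {\<omega>\<in>space M. V \<omega> = v j}"
      by auto
    then show "prob {\<omega>\<in>space M. U \<omega> = u i \<and> V \<omega> = v j} =
       prob {\<omega>\<in>space M. U \<omega> = u i} * prob {\<omega>\<in>space M. V \<omega> = v j}"
      using *[rule_format, of "{u i}" "{v j}"] by simp
  next
    fix A C assume R: ?R and AC: "A \<subseteq> range u" "C \<subseteq> range v"
    then have fin: "finite A" "finite C" by (auto intro: finite_subset)
    have "(U -` A \<inter> space M) \<inter> (V -` C \<inter> space M) = (\<lambda>\<omega>. (U \<omega>, V \<omega>)) -` (A \<times> C) \<inter> space M"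
      by auto
    then have "prob ((U -` A \<inter> space M) \<inter> (V -` C \<inter> space M)) =
        (\<Sum>p\<in>A \<times> C. prob {\<omega>\<in>space M. (U \<omega>, V \<omega>) = p})"
      using fin AC by (simp only:) (intro prob_in_finite[OF UV], auto)
    also have "\<dots> = (\<Sum>(a, c)\<in>A \<times> C. prob {\<omega>\<in>space M. U \<omega> = a} * prob {\<omega>\<in>space M. V \<omega> = c})"
    proof (rule sum.cong[OF refl], clarify)
      fix a c assume "a \<in> A" "c \<in> C"
      with AC obtain i j where "a = u i" "c = v j" by blast
      with R show "prob {\<omega>\<in>space M. (U \<omega>, V \<omega>) = (a, c)} =
          prob {\<omega>\<in>space M. U \<omega> = a} * prob {\<omega>\<in>space M. V \<omega> = c}"
        by simp
    qed
    also have "\<dots> = prob (U -` A \<inter> space M) * prob (V -` C \<inter> space M)"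
      using fin AC
      by (simp add: prob_in_finite[OF U] prob_in_finite[OF V] sum_product sum.cartesian_product)
    finally show "prob ((U -` A \<inter> space M) \<inter> (V -` C \<inter> space M)) =
       prob (U -` A \<inter> space M) * prob (V -` C \<inter> space M)" .
  qed
  finally show ?thesis
    using U V by (simp add: independent_rvs_def)
qed

section \<open>Conditioning on the measurement\<close>

lemma sigma_finite_generated_algebra:
  assumes "Z \<in> borel_measurable M"
  shows "sigma_finite_subalgebra M (generated_algebra M Z)"
proof (rule finite_measure_subalgebra_is_sigma_finite)
  have "subalgebra M (generated_algebra M Z)"
    using assms by (auto simp: subalgebra_def generated_algebra_def sets_vimage_algebra2
      intro: measurable_sets)
  then show "finite_measure_subalgebra M (generated_algebra M Z)"
    by unfold_locales
qed

text \<open>Almost surely the conditional probability of \<open>A \<inter> E\<close> is that of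
  \<open>E\<close> times the \<open>p l\<close> of the cell hit by \<open>Z\<close>. Integrating
  this removes the conditioning, because the cell events belong to the sigma-algebra generated by
  \<open>Z\<close>.\<close>

lemma prob_cells_randomization:
  fixes B :: "'l::finite \<Rightarrow> real set"
  assumes Z: "Z \<in> borel_measurable M" and B: "\<And>l. B l \<in> sets borel"
    and cells: "AE \<omega> in M. \<exists>!l. Z \<omega> \<in> B l"
    and [measurable]: "A \<in> events" "E \<in> events"
    and ci: "AE \<omega> in M. real_cond_exp M (generated_algebra M Z) (indicator (A \<inter> E)) \<omega> =
      real_cond_exp M (generated_algebra M Z) (indicator A) \<omega> *
      real_cond_exp M (generated_algebra M Z) (indicator E) \<omega>"
    and p: "\<And>l. AE \<omega> in M. Z \<omega> \<in> B l \<longrightarrow>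
      real_cond_exp M (generated_algebra M Z) (indicator A) \<omega> = p l"
  shows "prob (A \<inter> E) = (\<Sum>l\<in>UNIV. p l * prob ({\<omega>\<in>space M. Z \<omega> \<in> B l} \<inter> E))"
proof -
  let ?F = "generated_algebra M Z"
  let ?B = "\<lambda>l. {\<omega>\<in>space M. Z \<omega> \<in> B l}"
  interpret sigma_finite_subalgebra M ?F
    by (rule sigma_finite_generated_algebra[OF Z])
  have BF [measurable]: "?B l \<in> sets ?F" for l
  proof -
    have "?B l = Z -` B l \<inter> space M" by auto
    then show ?thesis
      using B[of l] unfolding generated_algebra_def by (simp add: in_vimage_algebra)
  qed
  have [measurable]: "?B l \<in> events" for l
    using BF[of l] subalg by (auto simp: subalgebra_def)
  have intg: "integrable M (\<lambda>\<omega>. indicator (?B l) \<omega> * indicator E \<omega> :: real)" for l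
    by (simp add: integrable_indicator_event flip: indicator_inter_arith)
  \<comment> \<open>This is the defining property of conditional expectation, tested against the
    indicator of a cell event.\<close>
  have ce: "integrable M (\<lambda>\<omega>. indicator (?B l) \<omega> * real_cond_exp M ?F (indicator E) \<omega>)"
    "(\<integral>\<omega>. indicator (?B l) \<omega> * real_cond_exp M ?F (indicator E) \<omega> \<partial>M) = prob (?B l \<inter> E)" for l
    using real_cond_exp_intg[OF intg[of l]] by (simp_all flip: indicator_inter_arith)
  \<comment> \<open>There are finitely many cells, so the exceptional null sets can be united and
    the quantifier moved inside.\<close>
  have "AE \<omega> in M. \<forall>l. Z \<omega> \<in> B l \<longrightarrow> real_cond_exp M ?F (indicator A) \<omega> = p l"
    using p by (simp add: AE_all_countable)
  with AE_space cells ci have AE: "AE \<omega> in M. real_cond_exp M ?F (indicator (A \<inter> E)) \<omega> =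
      (\<Sum>l\<in>UNIV. p l * (indicator (?B l) \<omega> * real_cond_exp M ?F (indicator E) \<omega>))"
  proof eventually_elim
    case (elim \<omega>)
    then obtain k where k: "\<And>l. Z \<omega> \<in> B l \<longleftrightarrow> l = k" by metis
    \<comment> \<open>Only the term of the cell \<open>k\<close> that contains
      \<open>Z \<omega>\<close> survives.\<close>
    have "(\<Sum>l\<in>UNIV. p l * (indicator (?B l) \<omega> * real_cond_exp M ?F (indicator E) \<omega>)) =
      (\<Sum>l\<in>UNIV. if l = k then p k * real_cond_exp M ?F (indicator E) \<omega> else 0)"
      using elim(1) by (intro sum.cong) (auto simp: k)
    then show ?case using elim k by simp
  qed
  have "prob (A \<inter> E) = (\<integral>\<omega>. real_cond_exp M ?F (indicator (A \<inter> E)) \<omega> \<partial>M)"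
    by (subst real_cond_exp_int(2)) (auto intro!: integrable_indicator_event)
  also have "\<dots> = (\<integral>\<omega>. (\<Sum>l\<in>UNIV. p l *
      (indicator (?B l) \<omega> * real_cond_exp M ?F (indicator E) \<omega>)) \<partial>M)"
    using AE by (intro integral_cong_AE) auto
  also have "\<dots> = (\<Sum>l\<in>UNIV. p l * prob (?B l \<inter> E))"
    using ce by simp
  finally show ?thesis .
qed

text \<open>Keeping \<open>C\<close> general serves three uses at once: the full rectangle gives the
  law of the estimator, and the two kinds of strips give its joint laws with \<open>X\<close> and
  with \<open>Y\<close>.\<close>

lemma randomized_estimator_joint_prob:
  fixes x :: "'n::finite \<Rightarrow> 'c" and y :: "'m::finite \<Rightarrow> 'b"
    and B :: "'l::{finite,linorder} \<Rightarrow> real set"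
  assumes X: "X \<in> measurable M (count_space (range x))"
    and Y: "Y \<in> measurable M (count_space (range y))"
    and Z: "Z \<in> borel_measurable M" and ac: "absolutely_continuous lborel (distr M borel Z)"
    and B: "interval_partition B" and W: "randomized_estimator M x X y Y Z B P W"
    and C: "C \<subseteq> range x \<times> range y"
  shows "prob {\<omega>\<in>space M. W \<omega> = y i \<and> (X \<omega>, Y \<omega>) \<in> C} =
    (\<Sum>l\<in>UNIV. P $ i $ l * prob {\<omega>\<in>space M. Z \<omega> \<in> B l \<and> (X \<omega>, Y \<omega>) \<in> C})"
proof -
  let ?A = "{\<omega>\<in>space M. W \<omega> = y i}" and ?E = "{\<omega>\<in>space M. (X \<omega>, Y \<omega>) \<in> C}"
  have XY: "(\<lambda>\<omega>. (X \<omega>, Y \<omega>)) \<in> measurable M (count_space (range x \<times> range y))"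
    using X Y by (intro measurable_Pair_count_space) auto
  have Wm: "W \<in> measurable M (count_space (range y))"
    using W by (simp add: randomized_estimator_def)
  have "?A = W -` {y i} \<inter> space M" "?E = (\<lambda>\<omega>. (X \<omega>, Y \<omega>)) -` C \<inter> space M" by auto
  then have ev: "?A \<in> events" "?E \<in> events"
    using C measurable_sets[OF Wm, of "{y i}"] measurable_sets[OF XY, of C] by auto
  note Bm = interval_partition_borel[OF B]
  \<comment> \<open>The point event is written as membership in a singleton to match the form of the
    events in \<open>cond_indep_given\<close>.\<close>
  have "{\<omega>\<in>space M. W \<omega> \<in> {y i} \<and> (X \<omega>, Y \<omega>) \<in> C} = ?A \<inter> ?E" by auto
  moreover have "cond_indep_given M Z (count_space (range y)) W
      (count_space (range x \<times> range y)) (\<lambda>\<omega>. (X \<omega>, Y \<omega>))"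
    using W by (simp add: randomized_estimator_def)
  ultimately have ci: "AE \<omega> in M. real_cond_exp M (generated_algebra M Z) (indicator (?A \<inter> ?E)) \<omega> =
      real_cond_exp M (generated_algebra M Z) (indicator ?A) \<omega> *
      real_cond_exp M (generated_algebra M Z) (indicator ?E) \<omega>"
    using C unfolding cond_indep_given_def
    by (auto dest!: bspec[of _ _ "{y i}"] bspec[of _ _ C])
  have "prob (?A \<inter> ?E) =
      (\<Sum>l\<in>UNIV. P $ i $ l * prob ({\<omega>\<in>space M. Z \<omega> \<in> B l} \<inter> ?E))"
    using W by (intro prob_cells_randomization[OF Z Bm AE_unique_cell[OF Z ac B] ev ci])
      (simp add: randomized_estimator_def)
  moreover have "?A \<inter> ?E = {\<omega>\<in>space M. W \<omega> = y i \<and> (X \<omega>, Y \<omega>) \<in> C}"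
    "{\<omega>\<in>space M. Z \<omega> \<in> B l} \<inter> ?E = {\<omega>\<in>space M. Z \<omega> \<in> B l \<and> (X \<omega>, Y \<omega>) \<in> C}" for l
    by auto
  ultimately show ?thesis by simp
qed

text \<open>Almost surely exactly one cell contains \<open>Z\<close>, so the indicators of the
  pieces of \<open>E\<close> add up to that of \<open>E\<close>. This is what makes the rows of
  \<open>Phi\<close> sum to zero.\<close>

lemma sum_cells:
  fixes B :: "'l::{finite,linorder} \<Rightarrow> real set"
  assumes Z: "Z \<in> borel_measurable M" and ac: "absolutely_continuous lborel (distr M borel Z)"
    and B: "interval_partition B" and E: "E \<in> events"
  shows "(\<Sum>l\<in>UNIV. prob {\<omega>\<in>E. Z \<omega> \<in> B l}) = prob E"
proof -
  note Bm = interval_partition_borel[OF B]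
  have "{\<omega>\<in>E. Z \<omega> \<in> B l} = E \<inter> (Z -` B l \<inter> space M)" for l
    using sets.sets_into_space[OF E] by auto
  then have ev: "{\<omega>\<in>E. Z \<omega> \<in> B l} \<in> events" for l
    using E measurable_sets[OF Z Bm] by simp
  have "prob E = (\<integral>\<omega>. indicator E \<omega> \<partial>M)" using E by simp
  also have "\<dots> = (\<integral>\<omega>. (\<Sum>l\<in>UNIV. indicator {\<omega>\<in>E. Z \<omega> \<in> B l} \<omega>) \<partial>M)"
  proof (rule integral_cong_AE)
    show "AE \<omega> in M. indicator E \<omega> = (\<Sum>l\<in>UNIV. indicator {\<omega>\<in>E. Z \<omega> \<in> B l} \<omega> :: real)"
      using AE_unique_cell[OF Z ac B]
    proof eventually_elim
      case (elim \<omega>)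
      then obtain k where k: "\<And>l. Z \<omega> \<in> B l \<longleftrightarrow> l = k" by metis
      have "(\<Sum>l\<in>UNIV. indicator {\<omega>\<in>E. Z \<omega> \<in> B l} \<omega> :: real) =
          (\<Sum>l\<in>UNIV. if l = k then indicator E \<omega> else 0)"
        by (intro sum.cong) (auto simp: k indicator_def)
      then show ?case by simp
    qed
  qed (use E ev in measurable)
  also have "\<dots> = (\<Sum>l\<in>UNIV. prob {\<omega>\<in>E. Z \<omega> \<in> B l})"
    using ev by (subst Bochner_Integration.integral_sum)
      (auto intro!: integrable_indicator_event)
  finally show ?thesis by simp
qed

end

section \<open>Linear constraints as polyhedra\<close>

lemma linear_functional_eq_inner:
  fixes g :: "'v::euclidean_space \<Rightarrow> real"
  assumes "linear g"
  obtains a where "\<And>v. g v = a \<bullet> v"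
  \<comment> \<open>The representing vector is the adjoint of \<open>g\<close> applied to the scalar
    1.\<close>
  using adjoint_works[OF assms, of _ 1] by (metis inner_commute inner_real_def mult_1)

lemma polyhedron_linear_ge:
  fixes g :: "'v::euclidean_space \<Rightarrow> real"
  assumes "linear g"
  shows "polyhedron {v. c \<le> g v}"
proof -
  obtain a where "\<And>v. g v = a \<bullet> v" using linear_functional_eq_inner[OF assms] by blast
  then show ?thesis by (simp add: polyhedron_halfspace_ge)
qed

lemma polyhedron_linear_eq:
  fixes g :: "'v::euclidean_space \<Rightarrow> real"
  assumes "linear g"
  shows "polyhedron {v. g v = c}"
proof -
  obtain a where "\<And>v. g v = a \<bullet> v" using linear_functional_eq_inner[OF assms] by blast
  then show ?thesis by (simp add: polyhedron_hyperplane)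
qed

theorem mainTheorem9:
  fixes M :: "'w measure"
    and x :: "'n::finite \<Rightarrow> 'a" and X :: "'w \<Rightarrow> 'a"
    and y :: "'m::finite \<Rightarrow> 'b" and Y :: "'w \<Rightarrow> 'b"
    and Z :: "'w \<Rightarrow> real"
    and B :: "'l::{finite,linorder} \<Rightarrow> real set"
    and Yhat :: "('m, 'l) randomization \<Rightarrow> 'w \<Rightarrow> 'b"
  assumes "prob_space M"
    and "inj x" and "X \<in> measurable M (count_space (range x))"
    and "\<And>j. \<P>(\<omega> in M. X \<omega> = x j) > 0"
    and "inj y" and "Y \<in> measurable M (count_space (range y))"
    and "\<And>i. \<P>(\<omega> in M. Y \<omega> = y i) > 0"
    and "Z \<in> borel_measurable M" and "absolutely_continuous lborel (distr M borel Z)"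
    and "interval_partition B"
    and "\<And>P. column_stochastic P \<Longrightarrow> randomized_estimator M x X y Y Z B P (Yhat P)"
  defines "risk \<equiv> \<lambda>P. \<integral>\<omega>. loss (Y \<omega>) (Yhat P \<omega>) \<partial>M"
    and "private_P \<equiv> \<lambda>P. column_stochastic P \<and>
           independent_rvs M (count_space (range y)) (Yhat P) (count_space (range x)) X"
    and "feasible_P \<equiv> \<lambda>P::('m, 'l) randomization.
           (\<forall>i l. 0 \<le> P $ i $ l) \<and> (\<forall>l. (\<Sum>i\<in>UNIV. P $ i $ l) = 1) \<and>
           (\<forall>i. Phi M x X Z B *v (P $ i) = 0)"
    and "gain \<equiv> \<lambda>P::('m, 'l) randomization. \<Sum>i\<in>UNIV. \<Sum>l\<in>UNIV.
           P $ i $ l * \<P>(\<omega> in M. Z \<omega> \<in> B l \<bar> Y \<omega> = y i) * \<P>(\<omega> in M. Y \<omega> = y i)"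
  shows "(\<exists>P. is_arg_min risk private_P P) \<and>
    (\<forall>P. is_arg_min risk private_P P \<longleftrightarrow> is_arg_min risk feasible_P P) \<and>
    linear_optimization_problem risk {P. feasible_P P} \<and>
    (\<forall>i l. linear (\<lambda>P::('m, 'l) randomization. P $ i $ l)) \<and>
    (\<forall>l. linear (\<lambda>P::('m, 'l) randomization. \<Sum>i\<in>UNIV. P $ i $ l)) \<and>
    (\<forall>i. linear (\<lambda>P::('m, 'l) randomization. Phi M x X Z B *v (P $ i))) \<and>
    linear gain \<and>
    (\<forall>P. column_stochastic P \<longrightarrow> risk P = 1 - gain P)"
proof -
  interpret prob_space M by (rule assms(1))
  note X = assms(3) and Y = assms(6) and Z = assms(8) and ac = assms(9) and B = assms(10)
  note version = assms(11)
  \<comment> \<open>Division by zero yields zero, so clearing the denominators of the conditional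
    probabilities relies on these facts.\<close>
  have px: "prob {\<omega>\<in>space M. X \<omega> = x j} \<noteq> 0" for j using assms(4)[of j] by simp
  have py: "prob {\<omega>\<in>space M. Y \<omega> = y i} \<noteq> 0" for i using assms(7)[of i] by simp
  have evX: "{\<omega>\<in>space M. X \<omega> = x j} \<in> events" for j
    using measurable_sets[OF X, of "{x j}"] by (simp add: vimage_def Int_def conj_commute)
  have Xr: "X \<omega> \<in> range x" and Yr: "Y \<omega> \<in> range y" if "\<omega> \<in> space M" for \<omega>
    using measurable_space[OF X that] measurable_space[OF Y that] by simp_all

  \<comment> \<open>Laws of the estimator, alone and jointly with the private and public
    variables\<close>
  have Wm: "Yhat P \<in> measurable M (count_space (range y))" if "column_stochastic P" for P
    using version[OF that] by (simp add: randomized_estimator_def)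
  have joint: "prob {\<omega>\<in>space M. Yhat P \<omega> = y i \<and> (X \<omega>, Y \<omega>) \<in> C} =
      (\<Sum>l\<in>UNIV. P $ i $ l * prob {\<omega>\<in>space M. Z \<omega> \<in> B l \<and> (X \<omega>, Y \<omega>) \<in> C})"
    if "column_stochastic P" "C \<subseteq> range x \<times> range y" for P i C
    using randomized_estimator_joint_prob[OF X Y Z ac B version[OF that(1)] that(2)] .
  have marg: "prob {\<omega>\<in>space M. Yhat P \<omega> = y i} =
      (\<Sum>l\<in>UNIV. P $ i $ l * prob {\<omega>\<in>space M. Z \<omega> \<in> B l})"
    if "column_stochastic P" for P i
    using joint[OF that, of "range x \<times> range y" i] Xr Yr by (simp cong: conj_cong)
  have jointX: "prob {\<omega>\<in>space M. Yhat P \<omega> = y i \<and> X \<omega> = x j} =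
      (\<Sum>l\<in>UNIV. P $ i $ l * prob {\<omega>\<in>space M. Z \<omega> \<in> B l \<and> X \<omega> = x j})"
    if "column_stochastic P" for P i j
    using joint[OF that, of "{x j} \<times> range y" i] Yr by (simp add: Sigma_mono cong: conj_cong)
  have jointY: "prob {\<omega>\<in>space M. Yhat P \<omega> = y i \<and> Y \<omega> = y i} =
      (\<Sum>l\<in>UNIV. P $ i $ l * prob {\<omega>\<in>space M. Z \<omega> \<in> B l \<and> Y \<omega> = y i})"
    if "column_stochastic P" for P i
    using joint[OF that, of "range x \<times> {y i}" i] Xr by (simp add: Sigma_mono cong: conj_cong)

  \<comment> \<open>Privacy as linear equations, and the risk as an affine function\<close>
  have Phi_mult: "(Phi M x X Z B *v (P $ i)) $ j =
      prob {\<omega>\<in>space M. Yhat P \<omega> = y i \<and> X \<omega> = x j} / prob {\<omega>\<in>space M. X \<omega> = x j} -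
      prob {\<omega>\<in>space M. Yhat P \<omega> = y i}"
    if "column_stochastic P" for P i j
    unfolding jointX[OF that] marg[OF that]
    by (simp add: Phi_def matrix_vector_mult_def cond_prob_def sum_divide_distrib
        sum_subtractf[symmetric] algebra_simps)
  \<comment> \<open>The two predicates agree outright, not just in their minimizers: both fail
    unless \<open>P\<close> is column stochastic, and for such \<open>P\<close> clearing the
    denominator in \<open>Phi_mult\<close> turns a zero entry into the product rule.\<close>
  have private_eq: "private_P = feasible_P"
  proof
    fix P
    have "independent_rvs M (count_space (range y)) (Yhat P) (count_space (range x)) X \<longleftrightarrow>
        (\<forall>i. Phi M x X Z B *v (P $ i) = 0)" if "column_stochastic P"
      using px by (simp add: independent_rvs_finite_iff[OF Wm[OF that] X] vec_eq_iff
          Phi_mult[OF that] divide_eq_eq)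
    then show "private_P P = feasible_P P"
      by (auto simp: private_P_def feasible_P_def column_stochastic_def)
  qed
  have risk_eq: "risk P = 1 - gain P" if P: "column_stochastic P" for P
  proof -
    let ?W = "Yhat P" and ?hit = "\<lambda>i. {\<omega>\<in>space M. Yhat P \<omega> = y i \<and> Y \<omega> = y i}"
    have WY: "(\<lambda>\<omega>. (?W \<omega>, Y \<omega>)) \<in> measurable M (count_space (range y \<times> range y))"
      using Wm[OF P] Y by (intro measurable_Pair_count_space) auto
    have D: "range (\<lambda>i. (y i, y i)) \<subseteq> range y \<times> range y" by auto
    \<comment> \<open>The estimator is correct exactly when the pair lies on the diagonal, since
      \<open>Y\<close> takes values in \<open>range y\<close>; the loss is one minus the indicator
      of this event.\<close>
    let ?D = "(\<lambda>\<omega>. (?W \<omega>, Y \<omega>)) -` (range (\<lambda>i. (y i, y i))) \<inter> space M"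
    have ev: "?D \<in> events"
      using measurable_sets[OF WY] D by simp
    have "\<omega> \<in> ?D \<longleftrightarrow> ?W \<omega> = Y \<omega>" if "\<omega> \<in> space M" for \<omega>
      using that Yr[OF that] by (auto simp: image_iff)
    then have "risk P = (\<integral>\<omega>. 1 - indicator ?D \<omega> \<partial>M)"
      unfolding risk_def
      by (intro Bochner_Integration.integral_cong)
        (simp_all add: loss_def indicator_def eq_commute del: vimage_eq)
    also have "\<dots> = 1 - prob ?D"
      using ev by (subst Bochner_Integration.integral_diff)
        (auto simp: prob_space intro!: integrable_indicator_event)
    also have "prob ?D = (\<Sum>p\<in>range (\<lambda>i. (y i, y i)). prob {\<omega>\<in>space M. (?W \<omega>, Y \<omega>) = p})"
      by (rule prob_in_finite[OF WY _ D]) simp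
    also have "\<dots> = (\<Sum>i\<in>UNIV. prob (?hit i))"
    proof -
      \<comment> \<open>Injectivity of \<open>y\<close> lets the sum over diagonal points be
        reindexed by \<open>i\<close> without merging terms.\<close>
      have "inj (\<lambda>i. (y i, y i))"
        using assms(5) by (auto simp: inj_def)
      then show ?thesis by (simp add: sum.reindex)
    qed
    also have "\<dots> = gain P"
      unfolding gain_def jointY[OF P] using py by (simp add: cond_prob_def mult.assoc)
    finally show ?thesis .
  qed

  \<comment> \<open>Linearity of the constraints and of the gain\<close>
  have linear_row: "linear (\<lambda>P::('m, 'l) randomization. P $ i)" for i
    by (rule linearI) simp_all
  have linear_entry: "linear (\<lambda>P::('m, 'l) randomization. P $ i $ l)" for i l
    by (rule linearI) simp_all
  have linear_col: "linear (\<lambda>P::('m, 'l) randomization. \<Sum>i\<in>UNIV. P $ i $ l)" for l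
    by (intro linear_compose_sum ballI linear_entry)
  have linear_Phi: "linear (\<lambda>P::('m, 'l) randomization. Phi M x X Z B *v (P $ i))" for i
    using linear_compose[OF linear_row matrix_vector_mul_linear] by (simp add: o_def)
  have linear_Phi_entry:
    "linear (\<lambda>P::('m, 'l) randomization. (Phi M x X Z B *v (P $ i)) $ j)" for i j
    using linear_compose[OF linear_Phi bounded_linear.linear[OF bounded_linear_vec_nth]]
    by (simp add: o_def)
  have linear_gain: "linear gain"
    unfolding gain_def
    by (rule linearI) (simp_all add: algebra_simps sum.distrib sum_distrib_left)

  \<comment> \<open>The feasible set as a polyhedron\<close>
  let ?S = "{P. feasible_P P}"
  have feasible_stochastic: "column_stochastic P" if "feasible_P P" for P
    using that by (simp add: feasible_P_def column_stochastic_def)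
  \<comment> \<open>The vector equations are split into coordinates, so that \<open>?S\<close> is a
    finite intersection of half-spaces and hyperplanes.\<close>
  have S_eq: "?S = (\<Inter>i. \<Inter>l. {P. 0 \<le> P $ i $ l}) \<inter>
      (\<Inter>l. {P. (\<Sum>i\<in>UNIV. P $ i $ l) = 1}) \<inter>
      (\<Inter>i. \<Inter>j. {P. (Phi M x X Z B *v (P $ i)) $ j = 0})"
    by (auto simp: feasible_P_def vec_eq_iff)
  have poly: "polyhedron ?S"
    unfolding S_eq
    by (intro polyhedron_Int polyhedron_Inter)
      (auto intro!: polyhedron_Inter polyhedron_linear_ge polyhedron_linear_eq
        linear_entry linear_col linear_Phi_entry)
  \<comment> \<open>On \<open>?S\<close> the risk is the linear part \<open>- gain P\<close> plus
    the constant 1.\<close>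
  have "linear (\<lambda>P. - gain P)"
    by (rule linear_compose_neg[OF linear_gain])
  then have lop: "linear_optimization_problem risk ?S"
    unfolding linear_optimization_problem_def using poly
    by (intro conjI exI[of _ "\<lambda>P. - gain P"] exI[of _ 1])
      (auto simp: risk_eq feasible_stochastic)

  \<comment> \<open>Compactness of the feasible set and existence of a minimizer\<close>
  have "bounded ?S"
  proof (rule boundedI)
    fix P assume "P \<in> ?S"
    then have P: "0 \<le> P $ i $ l" "(\<Sum>i\<in>UNIV. P $ i $ l) = 1" for i l
      by (auto simp: feasible_P_def)
    \<comment> \<open>The norm is at most the sum of the absolute values of all entries. These are
      nonnegative and each column sums to 1, so the bound is the number of columns.\<close>
    have "norm P \<le> (\<Sum>i\<in>UNIV. norm (P $ i))"
      unfolding norm_vec_def[of P] by (rule L2_set_le_sum) simp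
    also have "\<dots> \<le> (\<Sum>i\<in>UNIV. \<Sum>l\<in>UNIV. \<bar>P $ i $ l\<bar>)"
      by (intro sum_mono norm_le_l1_cart)
    also have "\<dots> = (\<Sum>l\<in>UNIV. \<Sum>i\<in>UNIV. P $ i $ l)"
      using P(1) by (subst sum.swap) simp
    finally show "norm P \<le> real CARD('l)"
      using P(2) by simp
  qed
  then have "compact ?S"
    using polyhedron_imp_closed[OF poly] by (simp add: compact_eq_bounded_closed)
  moreover have "?S \<noteq> {}"
  proof -
    \<comment> \<open>Guessing uniformly ignores the measurement. Each row of \<open>Phi\<close>
      sums to 1 - 1 = 0, so \<open>Phi\<close> annihilates every constant vector.\<close>
    let ?U = "(\<chi> i l. 1 / real CARD('m)) :: ('m, 'l) randomization"
    have cells: "(\<Sum>l\<in>UNIV. prob {\<omega>\<in>space M. Z \<omega> \<in> B l}) = 1"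
      using sum_cells[OF Z ac B sets.top] by (simp add: prob_space)
    have cellsX: "(\<Sum>l\<in>UNIV. prob {\<omega>\<in>space M. Z \<omega> \<in> B l \<and> X \<omega> = x j}) =
        prob {\<omega>\<in>space M. X \<omega> = x j}" for j
      using sum_cells[OF Z ac B evX[of j]] by (simp add: conj_ac)
    have "(Phi M x X Z B *v (?U $ i)) $ j = 0" for i j
      using px[of j] cells cellsX[of j]
      by (simp add: Phi_def matrix_vector_mult_def cond_prob_def sum_subtractf
          flip: sum_divide_distrib)
    then have "feasible_P ?U" by (simp add: feasible_P_def vec_eq_iff)
    then show ?thesis by blast
  qed
  moreover have "continuous_on ?S risk"
    \<comment> \<open>Feasible matrices are column stochastic, so on \<open>?S\<close> the risk may
      be replaced by the affine function \<open>1 - gain P\<close>, which is continuous.\<close>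
    using linear_continuous_on[of gain ?S] linear_gain
    by (subst continuous_on_cong[OF refl, of _ _ "\<lambda>P. 1 - gain P"])
      (auto intro!: continuous_intros simp: risk_eq feasible_stochastic linear_conv_bounded_linear)
  ultimately obtain P where "P \<in> ?S" "\<forall>Q\<in>?S. risk P \<le> risk Q"
    using continuous_attains_inf[of ?S risk] by blast
  then have "\<exists>P. is_arg_min risk private_P P"
    by (auto simp: private_eq is_arg_min_linorder)
  then show ?thesis
    using lop linear_entry linear_col linear_Phi linear_gain risk_eq by (simp add: private_eq)
qed

end
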